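(* Let $K\subseteq\{0,1\}^n$ be a totally-ordered multiple knapsack set, let $\{C_1,\ldots,C_k\}$ be a multi-cover for $K$, and let $\alpha^Tx\le\beta$ be the corresponding simple multi-cover inequality (S-MCI). Let $C_0=\bigcap_{h=1}^kC_h$, $C=\bigcup_{h=1}^kC_h$, and $N=\max_{i\in[n]}\alpha_i$. For each $t\in\{1,\ldots,N\}$ write $\{i\in C\setminus C_0\mid\alpha_i=t\}=\{i_{t,1},\ldots,i_{t,n_t}\}$ with $i_{t,1}<\cdots<i_{t,n_t}$. Assume that $C_0=\emptyset$, that each $C_h$ ($h\in[k]$) is a minimal cover for $K$, and that there are indices $h_1,\ldots,h_N\in[k]$ and $\ell_2,\ldots,\ell_N$ (with $\ell_t\in[n_{t-1}]$) such that: (i) for every $t=2,\ldots,N$: $i_{t,1}\in C_{h_t}$, $i_{1,n_1}\in C_{h_t}$, $i_{t-1,\ell_t}\notin C_{h_t}$, and $(C_{h_t}\cup\{i_{t-1,\ell_t}\})\setminus\{i_{t,n_t}\}$ is not a cover for $K$; (ii) $i_{1,1}\in C_{h_1}$, and for every $i'\in[n]\setminus C$ the set $(C_{h_1}\cup\{i'\})\setminus\{i_{1,1}\}$ is not a cover for $K$; (iii) $\alpha(C_{h_t})=\beta+1$ for every $t=1,\ldots,N$. Then $\alpha^Tx\le\beta$ is a facet-defining inequality of $\operatorname{conv}(K)$.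
   Context: Notation: $[n]=\{1,\ldots,n\}$; for a vector $\alpha\in\mathbb{R}^n$ and $S\subseteq[n]$, $\alpha(S)=\sum_{i\in S}\alpha_i$; $\chi^S$ is the incidence vector of $S$. Totally-ordered multiple knapsack set (TOMKS): a set $K=\{x\in\{0,1\}^n\mid Ax\le b\}$ where $A\in\mathbb{Z}_+^{m\times n}$, $b\in\mathbb{Z}_+^m$ (nonnegative integer entries), and the columns of $A$ form a chain in the componentwise order, indexed so that $A_{\cdot1}\ge A_{\cdot2}\ge\cdots\ge A_{\cdot n}$. A set $S\subseteq[n]$ is a cover for $K$ if $\chi^S\notin K$; it is a minimal cover if no proper subset of it is a cover. Dominance: for $S_1,S_2\subseteq[n]$, $S_1$ dominates $S_2$ (written $S_1\triangleright S_2$) if there is an injective function $f:S_2\to S_1$ with $f(i)\le i$ for all $i\in S_2$. Given a finite nonempty family $\mathscr{C}=\{C_1,\ldots,C_k\}$ of covers for $K$, let $C_0=\bigcap_{h=1}^kC_h$, $C=\bigcup_{h=1}^kC_h$, $\bar C_h=C\setminus C_h$. The discrepancy family is $\mathcal{D}(\mathscr{C})=\{C_1\setminus C_0,\ldots,C_k\setminus C_0\}$. The family $\mathscr{C}$ is a multi-cover for $K$ if for every $T\subseteq\bigcup_{D\in\mathcal{D}(\mathscr{C})}D$ with $T\notin\mathcal{D}(\mathscr{C})$ there is $D'\in\mathcal{D}(\mathscr{C})$ with $T\triangleright D'$ or $D'\triangleright T$. Simple multi-cover inequality (S-MCI): given a multi-cover $\{C_1,\ldots,C_k\}$, its S-MCI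 is the inequality $\alpha^Tx\le\beta$ determined as follows (a maximum or minimum over an empty set is taken to be $0$): $\alpha_i=0$ for $i\notin C$; for $i\in C\setminus C_0$, recursively from the largest element of $C\setminus C_0$ down to the smallest, $$\alpha_i=\Big(\max_{h\in[k]:\,i\in C_h}\ \max_{\ell\in\bar C_h:\,\ell>i}\alpha_\ell\Big)+1;$$ for $j\in C_0$, $$\alpha_j=\min_{h\in[k]}\max\Big\{\max_{\ell<j,\ \ell\in\bar C_h}\alpha_\ell,\ \sum_{\ell>j,\ \ell\in\bar C_h}\alpha_\ell+1\Big\};$$ and $\beta=\max_{h\in[k]}\alpha(C_h)-1$. *)

theory Defs
  imports "HOL-Analysis.Analysis"
begin

text \<open>
  The ground set \<open>[n]\<close> is rendered as an arbitrary finite linearly ordered type \<open>'n\<close>, i.e.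
  \<open>[n]\<close> with \<open>n = CARD('n)\<close> up to the unique order isomorphism, so that
  \<open>real ^ 'n\<close> is Euclidean \<open>n\<close>-space with ordered coordinates; the rows of the constraint
  matrix are indexed by a finite type \<open>'m\<close>. Nonnegative integers are \<open>nat\<close>.
\<close>

definition knapsack_set :: "nat ^ 'n ^ 'm \<Rightarrow> nat ^ 'm \<Rightarrow> (real ^ 'n) set" where
  "knapsack_set A b =
     {x. (\<forall>i. x $ i \<in> {0, 1}) \<and> (\<forall>r. (\<Sum>i\<in>UNIV. real (A $ r $ i) * x $ i) \<le> real (b $ r))}"

definition totally_ordered_columns :: "nat ^ 'n::{finite,linorder} ^ 'm \<Rightarrow> bool" where
  "totally_ordered_columns A \<longleftrightarrow> (\<forall>i j. i \<le> j \<longrightarrow> column j A \<le> column i A)"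

definition incidence_vector :: "'n set \<Rightarrow> real ^ 'n" where
  "incidence_vector S = (\<chi> i. indicator S i)"

definition cover :: "(real ^ 'n) set \<Rightarrow> 'n set \<Rightarrow> bool" where
  "cover K S \<longleftrightarrow> incidence_vector S \<notin> K"

definition minimal_cover :: "(real ^ 'n) set \<Rightarrow> 'n set \<Rightarrow> bool" where
  "minimal_cover K S \<longleftrightarrow> cover K S \<and> (\<forall>T. T \<subset> S \<longrightarrow> \<not> cover K T)"

definition dominates :: "'n::linorder set \<Rightarrow> 'n set \<Rightarrow> bool"  (infix "\<triangleright>" 50) where
  "S\<^sub>1 \<triangleright> S\<^sub>2 \<longleftrightarrow> (\<exists>f. inj_on f S\<^sub>2 \<and> f ` S\<^sub>2 \<subseteq> S\<^sub>1 \<and> (\<forall>i\<in>S\<^sub>2. f i \<le> i))"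

definition discrepancy_family :: "'n set set \<Rightarrow> 'n set set" where
  "discrepancy_family \<C> = (\<lambda>D. D - \<Inter>\<C>) ` \<C>"

definition multi_cover :: "(real ^ 'n::{finite,linorder}) set \<Rightarrow> 'n set set \<Rightarrow> bool" where
  "multi_cover K \<C> \<longleftrightarrow>
     finite \<C> \<and> \<C> \<noteq> {} \<and> (\<forall>D\<in>\<C>. cover K D) \<and>
     (\<forall>T. T \<subseteq> \<Union>(discrepancy_family \<C>) \<and> T \<notin> discrepancy_family \<C> \<longrightarrow>
        (\<exists>D'\<in>discrepancy_family \<C>. T \<triangleright> D' \<or> D' \<triangleright> T))"

text \<open>
  On \<open>nat\<close>, the supremum of a finite nonempty set is its maximum and the supremum of the
  empty set is \<open>0\<close>, which is exactly the convention for maxima over empty sets used here.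
  The recursion below gives the coefficients on \<open>\<Union>\<C> - \<Inter>\<C>\<close>; its values
  elsewhere are never used, since \<open>\<Union>\<C> - D \<subseteq> \<Union>\<C> - \<Inter>\<C>\<close> for
  \<open>D \<in> \<C>\<close>.
\<close>

function discrepancy_coeff :: "'n::{finite,linorder} set set \<Rightarrow> 'n \<Rightarrow> nat" where
  "discrepancy_coeff \<C> i =
     (SUP D\<in>{D \<in> \<C>. i \<in> D}. SUP l\<in>{l \<in> \<Union>\<C> - D. i < l}. discrepancy_coeff \<C> l) + 1"
  by pat_completeness auto
termination
  by (relation "Wellfounded.measure (\<lambda>(\<C>, i). card {l. i < l})")
    (auto intro!: psubset_card_mono)

declare discrepancy_coeff.simps [simp del]

definition smci_coeff :: "'n::{finite,linorder} set set \<Rightarrow> 'n \<Rightarrow> nat" where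
  "smci_coeff \<C> j =
     (if j \<notin> \<Union>\<C> then 0
      else if j \<notin> \<Inter>\<C> then discrepancy_coeff \<C> j
      else MIN D\<in>\<C>. max (SUP l\<in>{l \<in> \<Union>\<C> - D. l < j}. discrepancy_coeff \<C> l)
                        ((\<Sum>l\<in>{l \<in> \<Union>\<C> - D. j < l}. discrepancy_coeff \<C> l) + 1))"

definition smci_rhs :: "'n::{finite,linorder} set set \<Rightarrow> int" where
  "smci_rhs \<C> = int (MAX D\<in>\<C>. sum (smci_coeff \<C>) D) - 1"

definition facet_defining :: "'a::euclidean_space \<Rightarrow> real \<Rightarrow> 'a set \<Rightarrow> bool" where
  "facet_defining a c P \<longleftrightarrow> (\<forall>x\<in>P. a \<bullet> x \<le> c) \<and> {x \<in> P. a \<bullet> x = c} facet_of P"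

end

theory Submission
  imports Defs
begin

text \<open>
  Validity: an injection witnessing \<open>D \<triangleright> T\<close> can be rerouted to an injection from
  \<open>T - D\<close> to \<open>D - T\<close> that strictly decreases indices, and along such a pair the
  coefficients strictly increase by construction; hence every feasible \<open>T\<close> weighs strictly
  less than some member of the multi-cover.

  Facet: it suffices that a vector \<open>p\<close> orthogonal to all tight points vanishes. Removing a
  coefficient-one element from a tight cover, and exchanging an element of level \<open>t\<close> for one
  of level \<open>t - 1\<close>, give tight points which force \<open>p\<close> to be constant on each level, the
  level constants to form the arithmetic progression \<open>t * p\<^sub>1\<close>, and \<open>p\<close> to vanish off the
  union. So \<open>p = p\<^sub>1 \<alpha>\<close>, and \<open>p\<^sub>1 \<beta> = 0\<close> with \<open>\<beta> > 0\<close>.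
\<close>

section \<open>Incidence vectors, covers and dominance\<close>

lemma incidence_vector_nth [simp]: "incidence_vector S $ i = indicator S i"
  by (simp add: incidence_vector_def)

lemma inner_incidence_vector: "a \<bullet> incidence_vector S = (\<Sum>i\<in>S. a $ i)"
  by (simp add: inner_vec_def indicator_def of_bool_def if_distrib sum.If_cases cong: if_cong)

lemma incidence_vector_Collect_eq_1:
  assumes "\<And>i. x $ i \<in> {0, 1}"
  shows "incidence_vector {i. x $ i = 1} = x"
  using assms by (force simp: vec_eq_iff indicator_def)

lemma not_cover_knapsack_iff:
  fixes A :: "nat ^ 'n::finite ^ 'm"
  shows "\<not> cover (knapsack_set A b) S \<longleftrightarrow> (\<forall>r. (\<Sum>i\<in>S. A $ r $ i) \<le> b $ r)"
proof -
  have "(\<Sum>i\<in>UNIV. real (A $ r $ i) * indicator S i) = real (\<Sum>i\<in>S. A $ r $ i)" for r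
    by (simp add: indicator_def of_bool_def if_distrib sum.If_cases cong: if_cong)
  then have "(\<Sum>i\<in>UNIV. real (A $ r $ i) * indicator S i) \<le> real (b $ r) \<longleftrightarrow>
      (\<Sum>i\<in>S. A $ r $ i) \<le> b $ r" for r
    by (simp only: of_nat_le_iff)
  then show ?thesis
    by (simp add: cover_def knapsack_set_def) (simp add: indicator_def)
qed

lemma not_cover_subset:
  fixes A :: "nat ^ 'n::finite ^ 'm"
  assumes "\<not> cover (knapsack_set A b) S" "T \<subseteq> S"
  shows "\<not> cover (knapsack_set A b) T"
  using assms unfolding not_cover_knapsack_iff
  by (meson finite le_trans sum_mono2 zero_le)

lemma not_cover_empty:
  fixes A :: "nat ^ 'n::finite ^ 'm"
  shows "\<not> cover (knapsack_set A b) {}"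
  by (simp add: not_cover_knapsack_iff)

text \<open>Columns decrease with the index, so moving each item of \<open>S\<close> to the smaller
  index \<open>f i\<close> can only raise every row sum, and injectivity keeps the images distinct.
  A row violated by \<open>S\<close> is thus violated by \<open>T\<close>.\<close>

lemma cover_dominates:
  fixes A :: "nat ^ 'n::{finite,linorder} ^ 'm"
  assumes A: "totally_ordered_columns A"
    and cover: "cover (knapsack_set A b) S" and dom: "T \<triangleright> S"
  shows "cover (knapsack_set A b) T"
proof (rule ccontr)
  assume "\<not> cover (knapsack_set A b) T"
  then have T: "(\<Sum>i\<in>T. A $ r $ i) \<le> b $ r" for r
    by (simp add: not_cover_knapsack_iff)
  obtain f where f: "inj_on f S" "f ` S \<subseteq> T" "\<And>i. i \<in> S \<Longrightarrow> f i \<le> i"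
    using dom by (auto simp: dominates_def)
  have "(\<Sum>i\<in>S. A $ r $ i) \<le> b $ r" for r
  proof -
    have "(\<Sum>i\<in>S. A $ r $ i) \<le> (\<Sum>i\<in>S. A $ r $ f i)"
      using A f(3) by (intro sum_mono) (auto simp: totally_ordered_columns_def column_def less_eq_vec_def)
    also have "\<dots> = (\<Sum>i\<in>f ` S. A $ r $ i)"
      using f(1) by (simp add: sum.reindex)
    also have "\<dots> \<le> (\<Sum>i\<in>T. A $ r $ i)"
      using f(2) by (intro sum_mono2) auto
    finally show ?thesis using T[of r] by simp
  qed
  with cover show False using not_cover_knapsack_iff by blast
qed

lemma dominates_exchange:
  assumes "i \<le> j" "i \<notin> S" "j \<notin> S"
  shows "insert i S \<triangleright> insert j S"
  unfolding dominates_def using assms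
  by (intro exI[of _ "id(j := i)"]) (auto simp: inj_on_def)

lemma dominates_Diff:
  fixes S T :: "'n::{finite,linorder} set"
  assumes "S \<triangleright> T"
  shows "S - T \<triangleright> T - S"
proof -
  have "finite (T \<inter> S)" by simp
  then show ?thesis using assms
  proof (induction "T \<inter> S" arbitrary: S T)
    case empty
    then show ?case by (simp add: Diff_triv Int_commute)
  next
    case (insert x X)
    then have x: "x \<in> T" "x \<in> S" by auto
    obtain f where f: "inj_on f T" "f ` T \<subseteq> S" "\<And>i. i \<in> T \<Longrightarrow> f i \<le> i"
      using insert.prems by (auto simp: dominates_def)
    \<comment> \<open>To delete the common element \<open>x\<close>, whatever was sent to
      \<open>x\<close> is sent on to \<open>f x\<close>. Indices still do not increase, as f x \<le>
      x = f i \<le> i, and \<open>f x\<close> is free once \<open>x\<close> leaves the domain. If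
      \<open>f x = x\<close>, nothing else maps to \<open>x\<close> and no rerouting occurs.\<close>
    let ?g = "\<lambda>i. if f i = x then f x else f i"
    have "inj_on ?g (T - {x})"
      using f(1) x by (auto simp: inj_on_def)
    moreover have "?g ` (T - {x}) \<subseteq> S - {x}"
      using f(1,2) x by (auto simp: inj_on_def)
    moreover have "?g i \<le> i" if "i \<in> T - {x}" for i
      using f(3)[of i] f(3)[of x] that x(1) by auto
    ultimately have "S - {x} \<triangleright> T - {x}"
      unfolding dominates_def by blast
    moreover have "X = (T - {x}) \<inter> (S - {x})"
      using insert.hyps by auto
    ultimately have "(S - {x}) - (T - {x}) \<triangleright> (T - {x}) - (S - {x})"
      using insert.hyps(3) by blast
    moreover have "(S - {x}) - (T - {x}) = S - T" "(T - {x}) - (S - {x}) = T - S"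
      using x by auto
    ultimately show ?case by simp
  qed
qed

section \<open>Coefficients and validity of the inequality\<close>

lemma discrepancy_coeff_pos: "0 < discrepancy_coeff \<C> i"
  by (subst discrepancy_coeff.simps) simp

text \<open>The pair \<open>D\<close>, \<open>l\<close> is among those over which the recursion for
  \<open>i\<close> maximises, and the final \<open>+ 1\<close> makes the bound strict. Both validity
  and the structure of the levels rest on this.\<close>

lemma discrepancy_coeff_less:
  assumes "D \<in> \<C>" "i \<in> D" "l \<in> \<Union>\<C>" "l \<notin> D" "i < l"
  shows "discrepancy_coeff \<C> l < discrepancy_coeff \<C> i"
proof -
  let ?m = "\<lambda>D. SUP l\<in>{l \<in> \<Union>\<C> - D. i < l}. discrepancy_coeff \<C> l"
  have "discrepancy_coeff \<C> l \<le> ?m D"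
    using assms by (intro cSUP_upper) auto
  also have "\<dots> \<le> (SUP D\<in>{D \<in> \<C>. i \<in> D}. ?m D)"
    using assms by (intro cSUP_upper) auto
  finally show ?thesis
    by (subst (2) discrepancy_coeff.simps) simp
qed

lemma smci_coeff_eq_discrepancy:
  assumes "\<Inter>\<C> = {}" "j \<in> \<Union>\<C>"
  shows "smci_coeff \<C> j = discrepancy_coeff \<C> j"
  using assms by (auto simp: smci_coeff_def)

lemma sum_smci_coeff_less_dominates:
  assumes empty: "\<Inter>\<C> = {}" and D: "D \<in> \<C>" and T: "T \<subseteq> \<Union>\<C>" "T \<noteq> D" and dom: "D \<triangleright> T"
  shows "sum (smci_coeff \<C>) T < sum (smci_coeff \<C>) D"
proof -
  let ?\<alpha> = "smci_coeff \<C>"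
  have coeff: "?\<alpha> j = discrepancy_coeff \<C> j" if "j \<in> \<Union>\<C>" for j
    using empty that by (rule smci_coeff_eq_discrepancy)
  have "D - T \<triangleright> T - D" using dom by (rule dominates_Diff)
  then obtain g where g: "inj_on g (T - D)" "g ` (T - D) \<subseteq> D - T" "\<And>i. i \<in> T - D \<Longrightarrow> g i \<le> i"
    by (auto simp: dominates_def)
  have less: "?\<alpha> i < ?\<alpha> (g i)" if i: "i \<in> T - D" for i
  proof -
    have gi: "g i \<in> D" using g(2) i by blast
    then have "g i < i" using g(3)[OF i] i by (auto simp: le_less)
    then have "discrepancy_coeff \<C> i < discrepancy_coeff \<C> (g i)"
      using D gi T i by (intro discrepancy_coeff_less[of D]) auto
    moreover have "g i \<in> \<Union>\<C>" "i \<in> \<Union>\<C>" using gi D T i by auto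
    ultimately show ?thesis by (simp only: coeff)
  qed
  \<comment> \<open>If \<open>T - D\<close> is empty there is no pair to give strictness; it then
    comes from T \<noteq> D, which leaves an element of positive coefficient in
    \<open>D - T\<close>.\<close>
  have "sum ?\<alpha> (T - D) < sum ?\<alpha> (D - T)"
  proof (cases "T - D = {}")
    case True
    then obtain j where j: "j \<in> D - T" using T(2) by blast
    then have "j \<in> \<Union>\<C>" using D by blast
    then have "0 < ?\<alpha> j" by (simp only: coeff discrepancy_coeff_pos)
    with j have "0 < sum ?\<alpha> (D - T)"
      by (intro sum_pos2[of _ j]) auto
    with True show ?thesis by (simp only: sum.empty)
  next
    case False
    then have "sum ?\<alpha> (T - D) < (\<Sum>i\<in>T - D. ?\<alpha> (g i))"
      using less by (intro sum_strict_mono) auto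
    also have "\<dots> = sum ?\<alpha> (g ` (T - D))"
      using g(1) by (simp add: sum.reindex)
    also have "\<dots> \<le> sum ?\<alpha> (D - T)"
      using g(2) by (intro sum_mono2) auto
    finally show ?thesis .
  qed
  moreover have "sum ?\<alpha> T = sum ?\<alpha> (T - D) + sum ?\<alpha> (T \<inter> D)"
    "sum ?\<alpha> D = sum ?\<alpha> (D - T) + sum ?\<alpha> (T \<inter> D)"
    by (metis Int_commute add.commute finite sum.Int_Diff)+
  ultimately show ?thesis by simp
qed

lemma sum_smci_coeff_le_rhs:
  assumes "D \<in> \<C>"
  shows "int (sum (smci_coeff \<C>) D) \<le> smci_rhs \<C> + 1"
proof -
  have "sum (smci_coeff \<C>) D \<le> (MAX D\<in>\<C>. sum (smci_coeff \<C>) D)"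
    using assms by (intro Max_ge) auto
  then show ?thesis by (simp only: smci_rhs_def)
qed

lemma smci_valid_set:
  fixes A :: "nat ^ 'n::{finite,linorder} ^ 'm"
  assumes A: "totally_ordered_columns A"
    and mc: "multi_cover (knapsack_set A b) \<C>"
    and empty: "\<Inter>\<C> = {}"
    and S: "\<not> cover (knapsack_set A b) S"
  shows "int (sum (smci_coeff \<C>) S) \<le> smci_rhs \<C>"
proof -
  let ?T = "S \<inter> \<Union>\<C>"
  \<comment> \<open>With empty intersection, the comparability in the multi-cover property is a
    statement about the covers themselves.\<close>
  have fam: "discrepancy_family \<C> = \<C>"
    using empty by (simp add: discrepancy_family_def)
  have covers: "cover (knapsack_set A b) D" if "D \<in> \<C>" for D
    using mc that by (simp add: multi_cover_def)
  have T: "\<not> cover (knapsack_set A b) ?T"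
    using S by (rule not_cover_subset) simp
  then have "?T \<notin> \<C>" using covers by blast
  then obtain D where D: "D \<in> \<C>" "?T \<triangleright> D \<or> D \<triangleright> ?T"
    using mc unfolding multi_cover_def fam by (meson inf_le2)
  \<comment> \<open>The opposite comparison would make the feasible set \<open>?T\<close> a
    cover.\<close>
  then have "D \<triangleright> ?T"
    using cover_dominates[OF A covers[OF D(1)]] T by blast
  then have "sum (smci_coeff \<C>) ?T < sum (smci_coeff \<C>) D"
    using empty D(1) \<open>?T \<notin> \<C>\<close> by (intro sum_smci_coeff_less_dominates) auto
  moreover have "sum (smci_coeff \<C>) S = sum (smci_coeff \<C>) ?T"
    by (rule sum.mono_neutral_right) (auto simp: smci_coeff_def)
  ultimately show ?thesis using sum_smci_coeff_le_rhs[OF D(1)] by linarith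
qed

section \<open>A spanning criterion for facets\<close>

text \<open>An affine hull through the origin is a linear span, so the tight points together with 0
  have full affine dimension. Hence the hull is full-dimensional, and the face, one point short of
  that and inside a hyperplane, has codimension exactly one.\<close>

lemma facet_defining_convex_hullI:
  fixes a :: "'a::euclidean_space"
  assumes le: "\<And>x. x \<in> K \<Longrightarrow> a \<bullet> x \<le> c"
    and "0 \<in> K" "0 < c"
    and span: "span {x \<in> K. a \<bullet> x = c} = UNIV"
  shows "facet_defining a c (convex hull K)"
proof -
  let ?P = "convex hull K" and ?F = "{x \<in> convex hull K. a \<bullet> x = c}"
  have valid: "a \<bullet> x \<le> c" if "x \<in> ?P" for x
  proof -
    have "?P \<subseteq> {x. a \<bullet> x \<le> c}"
      using le by (intro hull_minimal) (auto simp: convex_halfspace_le)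
    with that show ?thesis by auto
  qed
  have F: "?F = ?P \<inter> {x. a \<bullet> x = c}" by auto
  have face: "?F face_of ?P"
    unfolding F using valid by (intro face_of_Int_supporting_hyperplane_le) (auto simp: convex_convex_hull)
  have sub: "{x \<in> K. a \<bullet> x = c} \<subseteq> ?F" by (auto intro: hull_inc)
  have spanF: "span ?F = UNIV" using span_mono[OF sub] span by auto
  have "?F \<noteq> {}"
  proof
    assume "?F = {}"
    then have "UNIV = {0::'a}" using spanF by (metis span_empty)
    then have "dim (UNIV :: 'a set) = 0" by (metis dim_eq_0 subset_refl)
    then show False by (simp add: dim_UNIV)
  qed
  \<comment> \<open>A point of the face satisfies a \<bullet> x = c > 0, so the equation defines a
    genuine hyperplane.\<close>
  then have "a \<noteq> 0" using \<open>0 < c\<close> by auto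
  have full: "aff_dim (insert 0 ?F) = DIM('a)"
  proof -
    have "affine hull (insert 0 ?F) = UNIV"
      using spanF by (simp add: affine_hull_insert_span_gen)
    then show ?thesis by (metis aff_dim_affine_hull aff_dim_UNIV)
  qed
  have "insert 0 ?F \<subseteq> ?P" using \<open>0 \<in> K\<close> by (auto intro: hull_inc)
  then have "aff_dim ?P = DIM('a)"
    using full aff_dim_subset[of "insert 0 ?F" ?P] aff_dim_le_DIM[of ?P] by linarith
  moreover have "aff_dim ?F \<le> DIM('a) - 1"
    using aff_dim_subset[of ?F "{x. a \<bullet> x = c}"] \<open>a \<noteq> 0\<close> by auto
  \<comment> \<open>Inserting one point raises the affine dimension by at most one.\<close>
  moreover have "aff_dim ?F \<ge> DIM('a) - 1"
    using full aff_dim_insert[of 0 ?F] by (auto split: if_splits)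
  ultimately show ?thesis
    using face \<open>?F \<noteq> {}\<close> valid by (auto simp: facet_defining_def facet_of_def)
qed

section \<open>The facet theorem\<close>

theorem theorem3:
  fixes A :: "nat ^ 'n::{finite,linorder} ^ 'm::finite" and b :: "nat ^ 'm"
    and K :: "(real ^ 'n::{finite,linorder}) set"
    and k :: nat and C :: "nat \<Rightarrow> 'n set"
    and \<alpha> :: "'n \<Rightarrow> nat" and \<beta> :: int and N :: nat
    and n :: "nat \<Rightarrow> nat" and i :: "nat \<Rightarrow> nat \<Rightarrow> 'n"
    and h :: "nat \<Rightarrow> nat" and l :: "nat \<Rightarrow> nat"
  assumes tomks: "totally_ordered_columns A" "K = knapsack_set A b"
    and multi_cover: "multi_cover K (C ` {1..k})"
    and smci: "\<alpha> = smci_coeff (C ` {1..k})" "\<beta> = smci_rhs (C ` {1..k})"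
    and N: "N = (MAX j. \<alpha> j)"
    and levels:
      "\<And>t. t \<in> {1..N} \<Longrightarrow> strict_mono_on {1..n t} (i t)"
      "\<And>t. t \<in> {1..N} \<Longrightarrow>
         i t ` {1..n t} = {j \<in> (\<Union>g\<in>{1..k}. C g) - (\<Inter>g\<in>{1..k}. C g). \<alpha> j = t}"
    and C0_empty: "(\<Inter>g\<in>{1..k}. C g) = {}"
    and minimal: "\<And>g. g \<in> {1..k} \<Longrightarrow> minimal_cover K (C g)"
    and h_range: "\<And>t. t \<in> {1..N} \<Longrightarrow> h t \<in> {1..k}"
    and l_range: "\<And>t. t \<in> {2..N} \<Longrightarrow> l t \<in> {1..n (t - 1)}"
    and cond_i: "\<And>t. t \<in> {2..N} \<Longrightarrow>
         i t 1 \<in> C (h t) \<and> i 1 (n 1) \<in> C (h t) \<and> i (t - 1) (l t) \<notin> C (h t) \<and>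
         \<not> cover K ((C (h t) \<union> {i (t - 1) (l t)}) - {i t (n t)})"
    and cond_ii: "i 1 1 \<in> C (h 1)"
      "\<And>i'. i' \<notin> (\<Union>g\<in>{1..k}. C g) \<Longrightarrow> \<not> cover K ((C (h 1) \<union> {i'}) - {i 1 1})"
    and cond_iii: "\<And>t. t \<in> {1..N} \<Longrightarrow> int (\<Sum>j\<in>C (h t). \<alpha> j) = \<beta> + 1"
  shows "facet_defining (\<chi> j. real (\<alpha> j)) (real_of_int \<beta>) (convex hull K)"
proof -
  let ?\<C> = "C ` {1..k}"
  note empty = C0_empty
  have coeff: "\<alpha> j = discrepancy_coeff ?\<C> j" if "j \<in> \<Union>?\<C>" for j
    using smci_coeff_eq_discrepancy[OF empty that] smci(1) by simp
  have pos: "0 < \<alpha> j" if "j \<in> \<Union>?\<C>" for j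
    using coeff[OF that] discrepancy_coeff_pos by metis
  have off: "\<alpha> j = 0" if "j \<notin> \<Union>?\<C>" for j
    using that unfolding smci(1) smci_coeff_def by presburger
  have covers: "cover K D" if "D \<in> ?\<C>" for D
    using multi_cover that unfolding multi_cover_def by blast
  have nonempty: "D \<noteq> {}" if "D \<in> ?\<C>" for D
    using covers[OF that] not_cover_empty tomks(2) by auto
  have valid: "int (sum \<alpha> S) \<le> \<beta>" if "\<not> cover K S" for S
    using smci_valid_set[OF tomks(1) multi_cover[unfolded tomks(2)] empty] that
    by (simp add: smci tomks(2))
  have fam: "?\<C> \<noteq> {}" using multi_cover by (simp add: multi_cover_def)
  have le_N: "\<alpha> j \<le> N" for j unfolding N by (intro Max_ge) auto
  have "N \<in> range \<alpha>" unfolding N by (intro Max_in) auto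
  then obtain jN where jN: "\<alpha> jN = N" by auto
  have "1 \<le> N"
  proof -
    obtain D where D: "D \<in> ?\<C>" using fam by blast
    then obtain j where "j \<in> D" using nonempty by blast
    with D pos[of j] le_N[of j] show ?thesis by fastforce
  qed
  have level: "i t ` {1..n t} = {j \<in> \<Union>?\<C>. \<alpha> j = t}" if "t \<in> {1..N}" for t
    using levels(2)[OF that] unfolding C0_empty Diff_empty .
  \<comment> \<open>Level \<open>N\<close> contains a maximiser of \<alpha>; any lower level
    \<open>t\<close> is inhabited because \<open>l (Suc t)\<close> indexes into it.\<close>
  have n_pos: "1 \<le> n t" if t: "t \<in> {1..N}" for t
  proof (cases "t = N")
    case True
    then have "jN \<in> i t ` {1..n t}"
      using jN off[of jN] \<open>1 \<le> N\<close> unfolding level[OF t] by fastforce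
    then show ?thesis by auto
  next
    case False
    then show ?thesis using l_range[of "Suc t"] t by auto
  qed
  have i_level: "i t s \<in> \<Union>?\<C>" "\<alpha> (i t s) = t" if "t \<in> {1..N}" "s \<in> {1..n t}" for t s
    using level[OF that(1)] that(2) by blast+
  have h_mem: "C (h t) \<in> ?\<C>" if "t \<in> {1..N}" for t
    using h_range[OF that] by blast
  have first: "i t 1 \<in> C (h t)" if "t \<in> {1..N}" for t
    using cond_i[of t] cond_ii(1) that by (cases "t = 1") auto
  \<comment> \<open>\<open>C (h t)\<close> contains the smallest element of level \<open>t\<close>.
    A larger element of that level missing from the cover would have a strictly smaller coefficient
    by \<open>discrepancy_coeff_less\<close>, so the whole level is contained.\<close>
  have level_subset: "j \<in> C (h t)" if t: "t \<in> {1..N}" and j: "j \<in> \<Union>?\<C>" "\<alpha> j = t" for t j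
  proof (rule ccontr)
    assume nin: "j \<notin> C (h t)"
    have "j \<in> i t ` {1..n t}" using level[OF t] j by blast
    then obtain s where s: "s \<in> {1..n t}" "j = i t s" by blast
    have "s \<noteq> 1" using s(2) nin first[OF t] by auto
    then have "i t 1 < j"
      using levels(1)[OF t] s unfolding strict_mono_on_def by auto
    then have "discrepancy_coeff ?\<C> j < discrepancy_coeff ?\<C> (i t 1)"
      using h_mem[OF t] first[OF t] j(1) nin by (intro discrepancy_coeff_less) auto
    then show False
      using coeff[OF j(1)] coeff[OF i_level(1)[OF t]] i_level(2)[OF t] j(2) n_pos[OF t] by auto
  qed
  have one: "1 \<in> {1..N}" using \<open>1 \<le> N\<close> by simp
  have i11: "i 1 1 \<in> \<Union>?\<C>" "\<alpha> (i 1 1) = 1"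
    using i_level[OF one] n_pos[OF one] by auto
  \<comment> \<open>Otherwise every cover weighs at most 1, so all coefficients on the union are 1.
    Then level 1 is the whole union, and \<open>C (h 1)\<close>, which contains it, is the singleton
    of \<open>i 1 1\<close>; every cover equals this singleton, against the empty
    intersection.\<close>
  have "0 < \<beta>"
  proof (rule ccontr)
    assume "\<not> 0 < \<beta>"
    then have D_le: "sum \<alpha> D \<le> 1" if "D \<in> ?\<C>" for D
      using sum_smci_coeff_le_rhs[OF that, folded smci] by linarith
    have \<alpha>1: "\<alpha> j = 1" if j: "j \<in> \<Union>?\<C>" for j
    proof -
      obtain D where D: "D \<in> ?\<C>" "j \<in> D" using j by blast
      then have "\<alpha> j \<le> sum \<alpha> D" by (intro member_le_sum) auto
      with D_le[OF D(1)] pos[OF j] show ?thesis by simp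
    qed
    have "D = {i 1 1}" if D: "D \<in> ?\<C>" for D
    proof -
      have Dsub: "D \<subseteq> C (h 1)"
        using level_subset[OF one] \<alpha>1 D by blast
      have "sum \<alpha> (C (h 1)) = card (C (h 1))"
        using \<alpha>1 h_mem[OF one] by (subst card_eq_sum, intro sum.cong) auto
      then have "card (C (h 1)) \<le> 1" using D_le[OF h_mem[OF one]] by simp
      then have "C (h 1) \<subseteq> {i 1 1}"
        using cond_ii(1) by (auto simp: card_le_Suc0_iff_eq)
      with Dsub nonempty[OF D] show ?thesis by blast
    qed
    then have "i 1 1 \<in> \<Inter>?\<C>" by blast
    with empty show False by blast
  qed
  let ?a = "(\<chi> j. real (\<alpha> j)) :: real ^ 'n::{finite,linorder}"
  let ?X = "{x \<in> K. ?a \<bullet> x = real_of_int \<beta>}"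
  have inner_a: "?a \<bullet> incidence_vector S = real (sum \<alpha> S)" for S
    by (simp add: inner_incidence_vector)
  show ?thesis
  proof (rule facet_defining_convex_hullI)
    fix x assume x: "x \<in> K"
    define S where "S = {j. x $ j = 1}"
    have xS: "x = incidence_vector S"
      unfolding S_def using x tomks(2) by (subst incidence_vector_Collect_eq_1) (auto simp: knapsack_set_def)
    then have "int (sum \<alpha> S) \<le> \<beta>" using x by (intro valid) (simp add: cover_def)
    then show "?a \<bullet> x \<le> real_of_int \<beta>"
      unfolding xS inner_a by linarith
  next
    show "0 \<in> K" by (simp add: tomks(2) knapsack_set_def)
    show "0 < real_of_int \<beta>" using \<open>0 < \<beta>\<close> by simp
    show "span ?X = UNIV"
    proof (rule ccontr)
      assume "span ?X \<noteq> UNIV"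
      then obtain p where p: "p \<noteq> 0" "span ?X \<subseteq> {x. p \<bullet> x = 0}"
        using span_not_univ_subset_hyperplane by blast
      have tight: "(\<Sum>j\<in>S. p $ j) = 0" if "\<not> cover K S" "int (sum \<alpha> S) = \<beta>" for S
      proof -
        have "incidence_vector S \<in> ?X"
          using that by (auto simp: cover_def inner_a)
        then show ?thesis
          using p(2) span_superset[of ?X] unfolding inner_incidence_vector[symmetric] by blast
      qed
      \<comment> \<open>Minimality makes the cover without \<open>j\<close> feasible, and dropping a
        coefficient of 1 lowers its weight from \<beta> + 1 to \<beta>.\<close>
      have remove: "(\<Sum>j\<in>C (h t). p $ j) = p $ j"
        if t: "t \<in> {1..N}" and j: "j \<in> C (h t)" "\<alpha> j = 1" for t j
      proof -
        have "\<not> cover K (C (h t) - {j})"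
          using minimal[OF h_range[OF t]] j unfolding minimal_cover_def by blast
        moreover have "int (sum \<alpha> (C (h t) - {j})) = \<beta>"
          using sum.remove[of "C (h t)" j \<alpha>] j cond_iii[OF t] by simp
        ultimately show ?thesis
          using tight sum.remove[of "C (h t)" j "($) p"] j by fastforce
      qed
      define q where "q = p $ (i 1 1)"
      have level1: "p $ j = q" if "j \<in> \<Union>?\<C>" "\<alpha> j = 1" for j
        using remove[OF one level_subset[OF one that] that(2)]
          remove[OF one cond_ii(1) i11(2)] by (simp add: q_def)
      \<comment> \<open>Each \<open>C (h t)\<close> contains the level-one element
        \<open>i 1 (n 1)\<close>: by \<open>cond_i\<close> for t \<ge> 2, by
        \<open>level_subset\<close> for \<open>t = 1\<close>. Removing it shows that all these
        covers have the same \<open>p\<close>-sum.\<close>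
      have sum_q: "(\<Sum>j\<in>C (h t). p $ j) = q" if t: "t \<in> {1..N}" for t
      proof -
        have i1: "i 1 (n 1) \<in> \<Union>?\<C>" "\<alpha> (i 1 (n 1)) = 1"
          using i_level[OF one] n_pos[OF one] by auto
        have "i 1 (n 1) \<in> C (h t)"
          using cond_i[of t] level_subset[OF one i1] t by (cases "t = 1") auto
        then show ?thesis using remove[OF t] level1 i1 by metis
      qed
      have level_value: "\<forall>j\<in>\<Union>?\<C>. \<alpha> j = t \<longrightarrow> p $ j = real t * q" if "1 \<le> t" "t \<le> N" for t
        using that
      proof (induction t rule: dec_induct)
        case base
        then show ?case using level1 by auto
      next
        case (step t)
        have t: "Suc t \<in> {1..N}" "t \<in> {1..N}" "Suc t \<in> {2..N}" using step by auto
        let ?u = "i t (l (Suc t))" and ?D = "C (h (Suc t))" and ?w = "i (Suc t) (n (Suc t))"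
        have "l (Suc t) \<in> {1..n t}" using l_range[OF t(3)] by simp
        then have u: "?u \<in> \<Union>?\<C>" "\<alpha> ?u = t" using i_level[OF t(2)] by blast+
        have D: "?u \<notin> ?D" "\<not> cover K ((?D \<union> {?u}) - {?w})" using cond_i[OF t(3)] by auto
        have w: "?w \<in> \<Union>?\<C>" "\<alpha> ?w = Suc t" using i_level[OF t(1)] n_pos[OF t(1)] by auto
        have wD: "?w \<in> ?D" using level_subset[OF t(1) w] .
        show ?case
        proof (intro ballI impI)
          fix j assume j: "j \<in> \<Union>?\<C>" "\<alpha> j = Suc t"
          have jD: "j \<in> ?D" using level_subset[OF t(1) j] .
          have "j \<in> i (Suc t) ` {1..n (Suc t)}" using level[OF t(1)] j by blast
          then obtain s where s: "s \<in> {1..n (Suc t)}" "j = i (Suc t) s" by blast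
          have "j \<le> ?w"
            using levels(1)[OF t(1)] s unfolding strict_mono_on_def
            by (cases "s = n (Suc t)") (auto intro: less_imp_le)
          \<comment> \<open>\<open>cond_i\<close> gives feasibility only when the largest element
            \<open>?w\<close> of the level is removed. Removing j \<le> ?w instead yields a set
            dominated by that one, hence also feasible.\<close>
          have "\<not> cover K (insert ?u (?D - {j}))"
          proof (cases "j = ?w")
            case True
            moreover have "insert ?u (?D - {?w}) = (?D \<union> {?u}) - {?w}" using D(1) wD by auto
            ultimately show ?thesis using D(2) by simp
          next
            case False
            let ?R = "insert ?u (?D - {j, ?w})"
            have eq: "insert j ?R = (?D \<union> {?u}) - {?w}" "insert ?w ?R = insert ?u (?D - {j})"
              using False jD wD D(1) by auto
            have "insert j ?R \<triangleright> insert ?w ?R"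
              using \<open>j \<le> ?w\<close> jD wD D(1) by (intro dominates_exchange) auto
            then show ?thesis
              using cover_dominates[OF tomks(1), of b] D(2) unfolding eq tomks(2) by blast
          qed
          \<comment> \<open>The exchange trades a coefficient \<open>Suc t\<close> for
            \<open>t\<close>, again lowering the weight from \<beta> + 1 to \<beta>.\<close>
          moreover have "int (sum \<alpha> (insert ?u (?D - {j}))) = \<beta>"
            using sum.remove[of ?D j \<alpha>] jD D(1) cond_iii[OF t(1)] u(2) j(2) by simp
          ultimately have "(\<Sum>x\<in>insert ?u (?D - {j}). p $ x) = 0" by (rule tight)
          then have "p $ ?u + ((\<Sum>x\<in>?D. p $ x) - p $ j) = 0"
            using jD D(1) by (simp add: sum_diff1)
          moreover have "p $ ?u = real t * q" using step u by auto
          ultimately show "p $ j = real (Suc t) * q"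
            using sum_q[OF t(1)] by (simp add: algebra_simps)
        qed
      qed
      have "p $ j = real (\<alpha> j) * q" for j
      proof (cases "j \<in> \<Union>?\<C>")
        case True
        then show ?thesis using level_value[of "\<alpha> j"] pos[OF True] le_N[of j] by auto
      next
        case False
        let ?D = "C (h 1)"
        have jD: "j \<notin> ?D" using False h_mem[OF one] by blast
        then have ij: "j \<noteq> i 1 1" using cond_ii(1) by auto
        have eq: "(?D \<union> {j}) - {i 1 1} = insert j (?D - {i 1 1})" using ij by auto
        \<comment> \<open>Outside the union, \<open>j\<close> replaces \<open>i 1 1\<close>:
          coefficient 0 for 1, so the set is tight. Its \<open>p\<close>-sum is
          \<open>q - q + p $ j\<close>, which forces \<open>p $ j = 0\<close>.\<close>
        have "\<not> cover K (insert j (?D - {i 1 1}))"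
          using cond_ii(2)[of j] False unfolding eq by simp
        moreover have "int (sum \<alpha> (insert j (?D - {i 1 1}))) = \<beta>"
          using sum.remove[of ?D "i 1 1" \<alpha>] cond_ii(1) jD cond_iii[OF one] off[OF False] i11(2) by simp
        ultimately have "(\<Sum>x\<in>insert j (?D - {i 1 1}). p $ x) = 0" by (rule tight)
        then have "p $ j = 0"
          using jD cond_ii(1) sum_q[OF one] by (simp add: sum_diff1 q_def)
        then show ?thesis using off[OF False] by simp
      qed
      then have p_eq: "p $ j = real (\<alpha> j) * q" for j .
      \<comment> \<open>The \<open>p\<close>-sum of \<open>C (h 1)\<close> is computed twice: it is
        \<open>q\<close>, and by proportionality also (\<beta> + 1) times \<open>q\<close>.\<close>
      have "q = (\<Sum>j\<in>C (h 1). p $ j)" using sum_q[OF one] by simp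
      also have "\<dots> = real (sum \<alpha> (C (h 1))) * q"
        by (simp add: p_eq sum_distrib_right)
      also have "real (sum \<alpha> (C (h 1))) = real_of_int \<beta> + 1"
        using cond_iii[OF one] by linarith
      finally have "real_of_int \<beta> * q = 0" by (simp add: algebra_simps)
      then have "q = 0" using \<open>0 < \<beta>\<close> by simp
      then have "p = 0" using p_eq by (simp add: vec_eq_iff)
      with p(1) show False by simp
    qed
  qed
qed

end
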